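(* Suppose that $p_0$ is a density on $[0,1]$ and $\inf_{x\in[0,1]}p_0(x)\ge c_0$ for some constant $c_0>0$. Let $(\epsilon_n)$ be a sequence with $\epsilon_n\downarrow0$ and $\epsilon_n\ge\sqrt{(\log n)/n}$. Assume that the prior satisfies $\Pi_n(\mathcal K_n)\ge e^{-n\epsilon_n^2}$ for all large enough $n$, where $$\mathcal K_n=\Big\{q\in\mathcal F:\int\log\frac{p_0}{q}\,dP_0\le\epsilon_n^2,\ \int\Big(\log\frac{p_0}{q}\Big)^2dP_0\le\epsilon_n^2\Big\},$$ and that $\Pi_n(P([0,1])=1)=1$. Then, for some constant $K>0$, $$\Pi_n\big(W_\infty(P,P_0)>K\epsilon_n\mid X_1,\ldots,X_n\big)\to0\quad\text{in probability.}$$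
   Context: Setting: $X_1,X_2,\ldots$ are i.i.d. random variables from a true distribution $P_0$ with Lebesgue density $p_0$. $\mathcal F$ is a collection of probability densities on $\mathbb R$ equipped with the weak topology, and $\Pi=\Pi_n$ is a prior (a probability measure on $\mathcal F$), which may depend on the sample size $n$. For a measurable $A\subset\mathcal F$ the posterior probability is $$\Pi_n(A\mid X_1,\ldots,X_n)=\frac{\int_A\prod_{i=1}^n q(X_i)/p_0(X_i)\,d\Pi_n(q)}{\int_{\mathcal F}\prod_{i=1}^n q(X_i)/p_0(X_i)\,d\Pi_n(q)}.$$ A density is identified with its probability measure, and $P$ inside $\Pi_n(\cdot)$ or $\Pi_n(\cdot\mid X_1,\ldots,X_n)$ denotes the random probability measure whose density is drawn from the prior or posterior, respectively. Convergence in probability is with respect to the true distribution $P_0$ of the data, as $n\to\infty$. Constants do not depend on $n$. Notation: $W_\infty(P,Q)=\lim_{p\to\infty}W_p(P,Q)$ with $W_p$ the Wasserstein metric of order $p$ on the real line; equivalently $$W_\infty(P,Q)=\inf\{\epsilon>0:P(A)\le Q(A^\epsilon)\ \text{for all Borel } A\subset\mathbb R\},$$ where $A^\epsilon=\{x:|x-y|<\epsilon\text{ for some }y\in A\}$. *)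

theory Defs
  imports "HOL-Probability.Probability"
begin

definition prob_density :: "(real \<Rightarrow> real) \<Rightarrow> bool" where
  "prob_density q \<longleftrightarrow>
     q \<in> borel_measurable borel \<and> (\<forall>x. 0 \<le> q x) \<and> (\<integral>\<^sup>+x. ennreal (q x) \<partial>lborel) = 1"

definition law :: "(real \<Rightarrow> real) \<Rightarrow> real measure" where
  "law q = density lborel (\<lambda>x. ennreal (q x))"

text \<open>The weak topology on a set of densities: the coarsest topology for which the integral of
  every bounded continuous function is continuous, each density being identified with its law.\<close>

definition weak_topology :: "(real \<Rightarrow> real) set \<Rightarrow> (real \<Rightarrow> real) topology" where
  "weak_topology F = topology_generated_by
     {{q \<in> F. (LINT x|law q. f x) \<in> U} | (f :: real \<Rightarrow> real) U.
        continuous_on UNIV f \<and> bounded (range f) \<and> open U}"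

definition weak_borel :: "(real \<Rightarrow> real) set \<Rightarrow> (real \<Rightarrow> real) measure" where
  "weak_borel F = sigma F {S. openin (weak_topology F) S}"

definition enlargement :: "real set \<Rightarrow> real \<Rightarrow> real set" where
  "enlargement A e = {x. \<exists>y\<in>A. \<bar>x - y\<bar> < e}"

text \<open>Extended-valued: the infimum is \<open>\<infinity>\<close> if no admissible radius exists.\<close>

definition W_infinity :: "real measure \<Rightarrow> real measure \<Rightarrow> ennreal" where
  "W_infinity P Q =
     (INF e \<in> {e. 0 < e \<and> (\<forall>A\<in>sets borel. measure P A \<le> measure Q (enlargement A e))}. ennreal e)"

text \<open>The two integrals are meant in the extended sense, with \<open>log (p0 / q) = \<infinity>\<close> where
  \<open>q = 0 < p0\<close>.  Because here \<open>ln 0 = 0\<close> and the integral of a non-integrable function is \<open>0\<close>,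
  the positivity and integrability forced by the finite bounds have to be stated explicitly.\<close>

definition KL_nbhd :: "(real \<Rightarrow> real) set \<Rightarrow> (real \<Rightarrow> real) \<Rightarrow> real \<Rightarrow> (real \<Rightarrow> real) set" where
  "KL_nbhd F p0 e = {q \<in> F.
     (AE x in law p0. 0 < q x) \<and>
     integrable (law p0) (\<lambda>x. ln (p0 x / q x)) \<and>
     integrable (law p0) (\<lambda>x. (ln (p0 x / q x))\<^sup>2) \<and>
     (LINT x|law p0. ln (p0 x / q x)) \<le> e\<^sup>2 \<and>
     (LINT x|law p0. (ln (p0 x / q x))\<^sup>2) \<le> e\<^sup>2}"

definition posterior ::
  "(real \<Rightarrow> real) measure \<Rightarrow> (real \<Rightarrow> real) \<Rightarrow> nat \<Rightarrow> (nat \<Rightarrow> real) \<Rightarrow> (real \<Rightarrow> real) set \<Rightarrow> real" where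
  "posterior Prior p0 n x A =
     (LINT q:A|Prior. (\<Prod>i=1..n. q (x i) / p0 (x i))) /
     (LINT q|Prior. (\<Prod>i=1..n. q (x i) / p0 (x i)))"

definition tendsto_in_probability :: "'a measure \<Rightarrow> (nat \<Rightarrow> 'a \<Rightarrow> real) \<Rightarrow> real \<Rightarrow> bool" where
  "tendsto_in_probability M Y c \<longleftrightarrow>
     (\<forall>n. Y n \<in> borel_measurable M) \<and>
     (\<forall>\<delta>>0. (\<lambda>n. measure M {\<omega> \<in> space M. \<bar>Y n \<omega> - c\<bar> > \<delta>}) \<longlonglongrightarrow> 0)"

end

theory Submission
  imports Defs "HOL-Real_Asymp.Real_Asymp"
begin

text \<open>On the line, the quantile coupling shows that \<open>W_infinity P Q \<le> e\<close> as soon as each distribution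
  function is dominated by the other one shifted by \<open>e\<close>. Since \<open>p0\<close> is bounded below by \<open>c0\<close>, a
  distribution on the unit interval at \<open>W_infinity\<close>-distance more than \<open>K \<epsilon>\<close> from the truth therefore
  has its distribution function at distance more than \<open>c0 K \<epsilon> / 2\<close> from the true one, even at a point
  of the grid of mesh \<open>1 / n\<close>. So it is enough to test with the empirical distribution function on this
  grid: Hoeffding's lemma bounds both error probabilities by \<open>exp (- C n \<epsilon>\<^sup>2)\<close>, with \<open>C\<close> as large as
  desired if \<open>K\<close> is large, while Chebyshev's inequality and the prior mass condition bound the
  evidence from below by \<open>exp (- 3 n \<epsilon>\<^sup>2) / 2\<close> with probability tending to one.\<close>

subsection \<open>The distance \<open>W_infinity\<close> and the weak topology\<close>

lemma law_simps [simp]: "sets (law q) = sets borel" "space (law q) = UNIV"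
  by (simp_all add: law_def)

lemma prob_densityD:
  assumes "prob_density q"
  shows "q \<in> borel_measurable borel" "0 \<le> q x" "(\<integral>\<^sup>+x. ennreal (q x) \<partial>lborel) = 1"
  using assms by (auto simp: prob_density_def)

lemma real_distribution_law:
  assumes "prob_density q"
  shows "real_distribution (law q)"
proof -
  note [measurable] = prob_densityD(1)[OF assms]
  have "emeasure (law q) (space (law q)) = 1"
    unfolding law_def using prob_densityD[OF assms] by (simp add: emeasure_density)
  then interpret prob_space "law q" by (rule prob_spaceI)
  show ?thesis by unfold_locales simp_all
qed

section \<open>Enlargements of sets and bounds on \<open>W_infinity\<close> from both sides\<close>

lemma open_enlargement: "open (enlargement A e)"
proof -
  have "enlargement A e = (\<Union>y\<in>A. ball y e)"
    by (auto simp: enlargement_def dist_real_def abs_minus_commute)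
  then show ?thesis by (simp add: open_UN)
qed

lemma enlargement_mono: "A \<subseteq> B \<Longrightarrow> d \<le> e \<Longrightarrow> enlargement A d \<subseteq> enlargement B e"
  unfolding enlargement_def by (fastforce intro: less_le_trans)

lemma enlargement_enlargement: "enlargement (enlargement A d) e \<subseteq> enlargement A (d + e)"
proof
  fix x assume "x \<in> enlargement (enlargement A d) e"
  then obtain y z where "\<bar>x - y\<bar> < e" "\<bar>y - z\<bar> < d" "z \<in> A"
    by (auto simp: enlargement_def)
  then show "x \<in> enlargement A (d + e)"
    unfolding enlargement_def by (auto intro!: bexI[of _ z])
qed

lemma measure_enlargement_mono:
  assumes "real_distribution Q" "A \<subseteq> B" "d \<le> e"
  shows "measure Q (enlargement A d) \<le> measure Q (enlargement B e)"
proof -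
  interpret Q: real_distribution Q by fact
  show ?thesis
    using enlargement_mono[OF assms(2,3)] open_enlargement by (intro Q.finite_measure_mono) auto
qed

text \<open>Only radii strictly above \<open>e\<close> have to be admissible, since an infimum need
  not be attained; this also covers \<open>e = 0\<close>, which is not itself a competitor.\<close>

lemma W_infinity_leI:
  assumes "\<And>d A. d > e \<Longrightarrow> A \<in> sets borel \<Longrightarrow> measure P A \<le> measure Q (enlargement A d)" "e \<ge> 0"
  shows "W_infinity P Q \<le> ennreal e"
proof (rule ennreal_le_epsilon)
  fix d :: real assume "0 < d"
  then have "W_infinity P Q \<le> ennreal (e + d)"
    unfolding W_infinity_def using assms by (intro INF_lower) auto
  then show "W_infinity P Q \<le> ennreal e + ennreal d"
    using assms \<open>0 < d\<close> by simp
qed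

text \<open>Admissible radii are upward closed because enlargements grow with the radius, so one
  violation at \<open>e\<close> rules out every smaller radius too.\<close>

lemma W_infinity_geI:
  assumes "real_distribution Q" "A \<in> sets borel" "measure Q (enlargement A e) < measure P A"
  shows "ennreal e \<le> W_infinity P Q"
  unfolding W_infinity_def
proof (rule INF_greatest)
  fix d assume d: "d \<in> {d. 0 < d \<and> (\<forall>A\<in>sets borel. measure P A \<le> measure Q (enlargement A d))}"
  have "\<not> d \<le> e"
    using measure_enlargement_mono[OF assms(1), of A A d e] assms d by force
  then show "ennreal e \<le> ennreal d" by (simp add: ennreal_leI)
qed

text \<open>Both laws are images of the uniform law on the open unit interval under their quantile
  functions \<open>P.I\<close> and \<open>Q.I\<close>. The shifted domination keeps the two
  quantiles within \<open>e\<close> of each other at every level, so this coupling moves no mass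
  farther than \<open>e\<close>.\<close>

lemma W_infinity_le_of_cdf_shift:
  assumes "real_distribution P" "real_distribution Q" "e \<ge> 0"
    and PQ: "\<And>x. cdf P x \<le> cdf Q (x + e)" and QP: "\<And>x. cdf Q x \<le> cdf P (x + e)"
  shows "W_infinity P Q \<le> ennreal e"
proof (rule W_infinity_leI)
  interpret P: cdf_distribution P using assms(1) by (simp add: cdf_distribution_def)
  interpret Q: cdf_distribution Q using assms(2) by (simp add: cdf_distribution_def)
  have close: "\<bar>P.I u - Q.I u\<bar> \<le> e" if "0 < u" "u < 1" for u
  proof -
    \<comment> \<open>The Galois connection between quantile and distribution function,
      \<open>u \<le> cdf P x\<close> iff \<open>P.I u \<le> x\<close>, is used in both
      directions.\<close>
    have "u \<le> cdf Q (P.I u + e)" "u \<le> cdf P (Q.I u + e)"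
      using P.pseudoinverse[OF that, of "P.I u"] Q.pseudoinverse[OF that, of "Q.I u"]
        PQ[of "P.I u"] QP[of "Q.I u"] by auto
    then show ?thesis
      using P.pseudoinverse[OF that, of "Q.I u + e"] Q.pseudoinverse[OF that, of "P.I u + e"] by auto
  qed
  let ?U = "restrict_space lborel {0<..<1::real} :: real measure"
  have [measurable]: "P.I \<in> ?U \<rightarrow>\<^sub>M borel" "Q.I \<in> ?U \<rightarrow>\<^sub>M borel"
    by simp_all
  interpret U: prob_space ?U
    by (auto simp add: emeasure_restrict_space space_restrict_space intro!: prob_spaceI)
  fix d and A :: "real set" assume d: "d > e" and A [measurable]: "A \<in> sets borel"
  have [measurable]: "enlargement A d \<in> sets borel"
    using open_enlargement by auto
  have "measure P A = measure (distr ?U borel P.I) A"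
    by (simp add: P.distr_I_eq_M)
  also have "\<dots> = measure ?U (P.I -` A \<inter> space ?U)"
    by (rule measure_distr) simp_all
  also have "\<dots> \<le> measure ?U (Q.I -` enlargement A d \<inter> space ?U)"
  proof (rule U.finite_measure_mono)
    show "P.I -` A \<inter> space ?U \<subseteq> Q.I -` enlargement A d \<inter> space ?U"
    proof
      fix u assume u: "u \<in> P.I -` A \<inter> space ?U"
      then have "\<bar>P.I u - Q.I u\<bar> \<le> e"
        by (intro close) (auto simp: space_restrict_space)
      with u d show "u \<in> Q.I -` enlargement A d \<inter> space ?U"
        by (auto simp: enlargement_def intro!: bexI[of _ "P.I u"])
    qed
  qed measurable
  also have "\<dots> = measure (distr ?U borel Q.I) (enlargement A d)"
    by (rule measure_distr[symmetric]) simp_all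
  also have "\<dots> = measure Q (enlargement A d)"
    by (simp add: Q.distr_I_eq_M)
  finally show "measure P A \<le> measure Q (enlargement A d)" .
qed fact

section \<open>Measurability of \<open>W_infinity\<close> for the weak topology\<close>

lemma openin_weak_topology_greater:
  fixes f :: "real \<Rightarrow> real"
  assumes "continuous_on UNIV f" "bounded (range f)"
  shows "openin (weak_topology F) {q \<in> F. a < (LINT x|law q. f x)}"
proof -
  have "openin (weak_topology F) {q \<in> F. (LINT x|law q. f x) \<in> {a<..}}"
    unfolding weak_topology_def using assms
    by (intro topology_generated_by_Basis) (blast intro: open_greaterThan)
  then show ?thesis by simp
qed

text \<open>Lower semicontinuity: a set violating the defining inequality at radius \<open>e\<close> can be taken
  compact, and replacing its indicator by a continuous cutoff costs an arbitrarily small part of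
  the radius.\<close>

lemma openin_W_infinity_greater:
  assumes F: "\<And>q. q \<in> F \<Longrightarrow> prob_density q" and Q: "real_distribution Q"
  shows "openin (weak_topology F) {q \<in> F. ennreal c < W_infinity (law q) Q}"
proof (subst openin_subopen, intro ballI)
  fix q assume q: "q \<in> {q \<in> F. ennreal c < W_infinity (law q) Q}"
  \<comment> \<open>\<open>ennreal\<close> sends negative reals to 0, so \<open>c\<close> is
    replaced by its positive part before radii are compared as reals.\<close>
  define b where "b = max c 0"
  have cb: "ennreal c = ennreal b"
    by (simp add: b_def max_def ennreal_neg)
  interpret P: real_distribution "law q"
    using q F by (intro real_distribution_law) auto
  have "\<not> W_infinity (law q) Q \<le> ennreal b"
    using q cb by (simp add: not_le)
  then obtain e A where e: "e > b" and A: "A \<in> sets borel"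
    and viol: "measure Q (enlargement A e) < measure (law q) A"
    using W_infinity_leI[of b "law q" Q] by (force simp: b_def)
  have "emeasure (law q) A = (SUP K\<in>{K. K \<subseteq> A \<and> compact K}. emeasure (law q) K)"
    by (rule inner_regular) (use A in \<open>auto simp: P.emeasure_eq_measure\<close>)
  moreover have "ennreal (measure Q (enlargement A e)) < emeasure (law q) A"
    using viol by (simp add: P.emeasure_eq_measure ennreal_less_iff)
  ultimately obtain C where C: "C \<subseteq> A" "compact C"
    and "ennreal (measure Q (enlargement A e)) < emeasure (law q) C"
    by (auto simp: less_SUP_iff)
  then have viol': "measure Q (enlargement A e) < measure (law q) C"
    by (simp add: P.emeasure_eq_measure ennreal_less_iff)
  then have "C \<noteq> {}"
    by (metis measure_empty measure_nonneg not_less)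
  \<comment> \<open>Half of the slack between \<open>e\<close> and \<open>b\<close> pays for the
    cutoff; the remaining radius \<open>e - d\<close> still exceeds \<open>b\<close>.\<close>
  define d where "d = (e - b) / 2"
  have d: "d > 0" "e - d > b" using e by (auto simp: d_def field_simps)
  \<comment> \<open>A Lipschitz cutoff squeezed between the indicators of \<open>C\<close> and of
    \<open>enlargement C d\<close>.\<close>
  define f where "f = (\<lambda>x. max 0 (1 - infdist x C / d))"
  have f01: "0 \<le> f x" "f x \<le> 1" for x
    using d infdist_nonneg[of x C] by (auto simp: f_def)
  have contf: "continuous_on UNIV f"
    unfolding f_def using d by (intro continuous_intros) auto
  have bddf: "bounded (range f)"
    using f01 by (auto simp: bounded_iff intro!: exI[of _ 1])
  have [measurable]: "f \<in> borel_measurable borel"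
    using contf by (rule borel_measurable_continuous_onI)
  have fC: "f x = 1" if "x \<in> C" for x
    using that by (simp add: f_def)
  have fout: "f x = 0" if "x \<notin> enlargement C d" for x
  proof -
    obtain y where "y \<in> C" "infdist x C = dist x y"
      using infdist_attains_inf[OF compact_imp_closed[OF C(2)] \<open>C \<noteq> {}\<close>] by blast
    with that have "d \<le> infdist x C"
      by (auto simp: enlargement_def dist_real_def not_less)
    with d show ?thesis by (simp add: f_def)
  qed
  let ?T = "{q \<in> F. measure Q (enlargement A e) < (LINT x|law q. f x)}"
  have "openin (weak_topology F) ?T"
    by (intro openin_weak_topology_greater contf bddf)
  moreover have "q \<in> ?T"
  proof -
    have "C \<in> sets borel" using C(2) by (intro borel_closed compact_imp_closed)
    then have "measure (law q) C = (LINT x|law q. indicator C x)" by simp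
    also have "\<dots> \<le> (LINT x|law q. f x)"
    proof (rule integral_mono)
      show "integrable (law q) f"
        by (rule P.integrable_const_bound[of _ 1]) (use f01 in auto)
      show "indicator C x \<le> f x" for x
        using fC[of x] f01[of x] by (auto simp: indicator_def)
    qed (use \<open>C \<in> sets borel\<close> in \<open>auto simp: P.emeasure_eq_measure\<close>)
    finally show ?thesis using viol' q by auto
  qed
  moreover have "?T \<subseteq> {q \<in> F. ennreal c < W_infinity (law q) Q}"
  proof safe
    fix r assume r: "r \<in> F" and less: "measure Q (enlargement A e) < (LINT x|law r. f x)"
    interpret R: real_distribution "law r"
      using r F by (intro real_distribution_law) auto
    have G: "enlargement C d \<in> sets borel" using open_enlargement by auto
    have "(LINT x|law r. f x) \<le> (LINT x|law r. indicator (enlargement C d) x)"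
    proof (rule integral_mono)
      show "integrable (law r) f"
        by (rule R.integrable_const_bound[of _ 1]) (use f01 in auto)
      show "f x \<le> indicator (enlargement C d) x" for x
        using fout[of x] f01[of x] by (auto simp: indicator_def)
    qed (use G in \<open>auto simp: R.emeasure_eq_measure\<close>)
    also have "\<dots> = measure (law r) (enlargement C d)" using G by simp
    finally have "(LINT x|law r. f x) \<le> measure (law r) (enlargement C d)" .
    \<comment> \<open>For every \<open>r\<close> in the neighbourhood, the violation by
      \<open>A\<close> at radius \<open>e\<close> becomes one by \<open>enlargement C d\<close> at
      radius \<open>e - d\<close>.\<close>
    moreover have "measure Q (enlargement (enlargement C d) (e - d)) \<le> measure Q (enlargement A e)"
    proof -
      interpret Q: real_distribution Q by fact
      have "enlargement (enlargement C d) (e - d) \<subseteq> enlargement A e"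
        using enlargement_enlargement[of C d "e - d"] enlargement_mono[OF C(1), of e e] by auto
      then show ?thesis
        using open_enlargement by (intro Q.finite_measure_mono) auto
    qed
    ultimately have "ennreal (e - d) \<le> W_infinity (law r) Q"
      using less by (intro W_infinity_geI[OF Q G]) linarith
    moreover have "ennreal b < ennreal (e - d)"
      using d(2) by (intro ennreal_lessI) (auto simp: b_def)
    ultimately show "ennreal c < W_infinity (law r) Q"
      using cb by auto
  qed
  ultimately show "\<exists>T. openin (weak_topology F) T \<and> q \<in> T \<and>
      T \<subseteq> {q \<in> F. ennreal c < W_infinity (law q) Q}"
    by blast
qed

lemma topspace_weak_topology [simp]: "topspace (weak_topology F) = F"
proof -
  \<comment> \<open>The zero test function turns all of \<open>F\<close> into a subbasic
    set.\<close>
  have "openin (weak_topology F) {q \<in> F. - 1 < (LINT x|law q. (0::real))}"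
    by (rule openin_weak_topology_greater[of "\<lambda>_. 0"]) auto
  then have "openin (weak_topology F) F" by simp
  moreover have "topspace (weak_topology F) \<subseteq> F"
    unfolding weak_topology_def topology_generated_by_topspace by auto
  ultimately show ?thesis by (auto dest: openin_subset)
qed

lemma weak_borel_open: "openin (weak_topology F) S \<Longrightarrow> S \<in> sets (weak_borel F)"
  unfolding weak_borel_def using openin_subset[of "weak_topology F"]
  by (auto simp: sets_measure_of_conv)

lemma space_weak_borel [simp]: "space (weak_borel F) = F"
  unfolding weak_borel_def using openin_subset[of "weak_topology F"]
  by (auto simp: space_measure_of_conv)

subsection \<open>Separation of distribution functions\<close>

lemma cdf_unit_interval:
  assumes "real_distribution P" "measure P {0..1} = 1"
  shows "x < 0 \<Longrightarrow> cdf P x = 0" "1 \<le> x \<Longrightarrow> cdf P x = 1"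
proof -
  interpret P: real_distribution P by fact
  show "cdf P x = 0" if "x < 0"
  proof -
    have "P.prob {..x} + P.prob {0..1} = P.prob ({..x} \<union> {0..1})"
      using that by (intro P.finite_measure_Union[symmetric]) auto
    also have "\<dots> \<le> P.prob {0..1}"
      using assms(2) P.prob_le_1 by metis
    finally show ?thesis
      using measure_nonneg[of P "{..x}"] unfolding cdf_def2 by linarith
  qed
  show "cdf P x = 1" if "1 \<le> x"
  proof -
    have "P.prob {0..1} \<le> P.prob {..x}"
      using that by (intro P.finite_measure_mono) auto
    then show ?thesis
      using assms(2) P.cdf_bounded_prob[of x] unfolding cdf_def2 by linarith
  qed
qed

lemma cdf_law_increment:
  assumes p: "prob_density p" and c: "\<And>x. x \<in> {0..1} \<Longrightarrow> c \<le> p x"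
    and xy: "0 \<le> x" "x \<le> y" "y \<le> 1"
  shows "c * (y - x) \<le> cdf (law p) y - cdf (law p) x"
\<comment> \<open>The integral estimate runs in \<open>ennreal\<close> and needs a positive
  \<open>c\<close>; otherwise the left side is at most 0 and monotonicity of the distribution
  function is enough.\<close>
proof (cases "x < y \<and> c > 0")
  case True
  note [measurable] = prob_densityD(1)[OF p]
  interpret P: real_distribution "law p" by (rule real_distribution_law[OF p])
  have "ennreal (c * (y - x)) = (\<integral>\<^sup>+z. ennreal c * indicator {x<..y} z \<partial>lborel)"
    using True by (simp add: nn_integral_cmult_indicator ennreal_mult)
  also have "\<dots> \<le> (\<integral>\<^sup>+z. ennreal (p z) * indicator {x<..y} z \<partial>lborel)"
    using xy c by (intro nn_integral_mono) (auto simp: indicator_def intro!: ennreal_leI)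
  also have "\<dots> = emeasure (law p) {x<..y}"
    unfolding law_def by (simp add: emeasure_density)
  finally show ?thesis
    using True by (simp add: P.emeasure_eq_measure P.cdf_diff_eq)
next
  case False
  interpret P: real_distribution "law p" by (rule real_distribution_law[OF p])
  have "c * (y - x) \<le> 0"
    using False xy by (auto simp: mult_nonpos_nonneg)
  also have "0 \<le> cdf (law p) y - cdf (law p) x"
    using P.cdf_nondecreasing[OF xy(2)] by simp
  finally show ?thesis .
qed

text \<open>Rounding up to the grid with \<open>j = \<lceil>n x\<rceil>\<close>. A natural index
  cannot serve negative \<open>x\<close>, so both conclusions leave that case open.\<close>

lemma grid_point:
  assumes "n > 0"
  obtains j where "(x::real) < 0 \<or> x \<le> real j / real n" "x < 0 \<or> real j / real n < x + 1 / real n"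
proof (cases "x < 0")
  case False
  define j where "j = nat \<lceil>real n * x\<rceil>"
  have "real j = of_int \<lceil>real n * x\<rceil>"
    using False assms by (simp add: j_def)
  then have "real n * x \<le> real j" "real j < real n * x + 1"
    by linarith+
  then show ?thesis
    using assms by (intro that[of j]) (auto simp: field_simps)
qed (auto intro: that)

text \<open>By contraposition of the quantile coupling bound, one distribution function at some
  \<open>x\<close> exceeds the other at \<open>x + e\<close>. Moving to a grid point costs at most
  \<open>e / 2\<close>; over the other half of the interval the distribution function of
  \<open>p\<close> rises by at least \<open>c * e / 2\<close>, which is the gap.\<close>

lemma W_infinity_gt_imp_cdf_gap_on_grid:
  assumes P: "real_distribution P" and P01: "measure P {0..1} = 1"
    and p: "prob_density p" and p01: "measure (law p) {0..1} = 1"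
    and c: "\<And>x. x \<in> {0..1} \<Longrightarrow> c \<le> p x" and "c > 0"
    and n: "n > 0" "2 / real n \<le> e" and W: "W_infinity P (law p) > ennreal e"
  obtains j where "j \<le> n"
    "\<bar>cdf P (real j / real n) - cdf (law p) (real j / real n)\<bar> > c * e / 2"
proof -
  let ?Q = "law p"
  have Q: "real_distribution ?Q" by (rule real_distribution_law[OF p])
  interpret P: real_distribution P by fact
  interpret Q: real_distribution ?Q by fact
  have "0 < 2 / real n" using n by simp
  with n have e: "e > 0" by linarith
  have half: "1 / real n \<le> e / 2" using n by (simp add: field_simps)
  have "\<not> ((\<forall>x. cdf P x \<le> cdf ?Q (x + e)) \<and> (\<forall>x. cdf ?Q x \<le> cdf P (x + e)))"
    using W W_infinity_le_of_cdf_shift[OF P Q, of e] e by (auto simp: not_le[symmetric])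
  then consider x where "cdf P x > cdf ?Q (x + e)" | x where "cdf ?Q x > cdf P (x + e)"
    by (auto simp: not_le)
  then show thesis
  proof cases
    case (1 x)
    \<comment> \<open>Outside this range the larger value would be 0 or the smaller one 1, so the
      density bound applies on the whole interval from \<open>x\<close> to
      \<open>x + e\<close>.\<close>
    have x: "0 \<le> x" "x + e < 1"
      using 1 cdf_unit_interval[OF P P01, of x] Q.cdf_nonneg[of "x + e"]
        cdf_unit_interval[OF Q p01, of "x + e"] P.cdf_bounded_prob[of x] by (auto simp: not_le[symmetric])
    obtain j where j: "x \<le> real j / real n" "real j / real n < x + 1 / real n"
      using grid_point[OF n(1), of x] x by auto
    define t where "t = real j / real n"
    have t: "x \<le> t" "t + e / 2 \<le> x + e" "t \<le> 1" "0 \<le> t"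
      using j half x e by (auto simp: t_def)
    have "c * (e / 2) \<le> cdf ?Q (t + e / 2) - cdf ?Q t"
      using cdf_law_increment[OF p c, of t "t + e / 2"] t x e by auto
    moreover have "cdf ?Q (t + e / 2) \<le> cdf ?Q (x + e)" "cdf P x \<le> cdf P t"
      using t by (auto intro: Q.cdf_nondecreasing P.cdf_nondecreasing)
    ultimately have "c * e / 2 < \<bar>cdf P t - cdf ?Q t\<bar>" using 1 by linarith
    moreover have "j \<le> n" using t n by (simp add: t_def)
    ultimately show thesis using that[of j] by (simp add: t_def)
  next
    case (2 x)
    have x: "0 \<le> x" "x + e < 1"
      \<comment> \<open>As in the first case, with the roles of the two laws exchanged.\<close>
      using 2 cdf_unit_interval[OF Q p01, of x] P.cdf_nonneg[of "x + e"]
        cdf_unit_interval[OF P P01, of "x + e"] Q.cdf_bounded_prob[of x] by (auto simp: not_le[symmetric])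
    \<comment> \<open>Here \<open>law p\<close> is the larger one at \<open>x\<close>, so its
      increase is collected to the left of the grid point; rounding therefore starts from
      \<open>x + e / 2\<close>.\<close>
    obtain j where j: "x + e / 2 \<le> real j / real n" "real j / real n < x + e / 2 + 1 / real n"
      using grid_point[OF n(1), of "x + e / 2"] x e by auto
    define t where "t = real j / real n"
    have t: "x \<le> t - e / 2" "t \<le> x + e" "t \<le> 1"
      using j half x e by (auto simp: t_def)
    have "c * (e / 2) \<le> cdf ?Q t - cdf ?Q (t - e / 2)"
      using cdf_law_increment[OF p c, of "t - e / 2" t] t x e by auto
    moreover have "cdf ?Q x \<le> cdf ?Q (t - e / 2)" "cdf P t \<le> cdf P (x + e)"
      using t by (auto intro: Q.cdf_nondecreasing P.cdf_nondecreasing)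
    ultimately have "c * e / 2 < \<bar>cdf P t - cdf ?Q t\<bar>" using 2 by linarith
    moreover have "j \<le> n" using t n by (simp add: t_def)
    ultimately show thesis using that[of j] by (simp add: t_def)
  qed
qed

subsection \<open>Likelihood ratios of an i.i.d. sample\<close>

text \<open>Bienayme's identity: independence and centring kill the cross term at each insertion.
  Integrability is part of the induction because the expectation is split into its summands.\<close>

lemma (in prob_space) sum_indep_centered_second_moment:
  fixes Z :: "'i \<Rightarrow> 'a \<Rightarrow> real"
  assumes "finite I" "indep_vars (\<lambda>_. borel) Z I"
    and "\<And>i. i \<in> I \<Longrightarrow> integrable M (Z i)" "\<And>i. i \<in> I \<Longrightarrow> integrable M (\<lambda>x. (Z i x)\<^sup>2)"
    and "\<And>i. i \<in> I \<Longrightarrow> expectation (Z i) = 0"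
  shows "integrable M (\<lambda>x. (\<Sum>i\<in>I. Z i x)\<^sup>2) \<and>
    expectation (\<lambda>x. (\<Sum>i\<in>I. Z i x)\<^sup>2) = (\<Sum>i\<in>I. expectation (\<lambda>x. (Z i x)\<^sup>2))"
  using assms
proof (induction I rule: finite_induct)
  case (insert i I)
  let ?S = "\<lambda>x. \<Sum>i\<in>I. Z i x"
  have IH: "integrable M (\<lambda>x. (?S x)\<^sup>2)"
    "expectation (\<lambda>x. (?S x)\<^sup>2) = (\<Sum>i\<in>I. expectation (\<lambda>x. (Z i x)\<^sup>2))"
    using insert.IH insert.prems indep_vars_subset[of "\<lambda>_. borel" Z "insert i I" I] by auto
  have S: "integrable M ?S"
    using insert.prems by (intro Bochner_Integration.integrable_sum) auto
  have ind: "indep_var borel (Z i) borel ?S"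
    using insert by (intro indep_vars_sum) auto
  have Zi: "integrable M (Z i)" "integrable M (\<lambda>x. (Z i x)\<^sup>2)" "expectation (Z i) = 0"
    using insert.prems by auto
  have mix: "integrable M (\<lambda>x. Z i x * ?S x)" "expectation (\<lambda>x. Z i x * ?S x) = 0"
    using indep_var_integrable[OF ind Zi(1) S] indep_var_lebesgue_integral[OF ind Zi(1) S] Zi by auto
  have expand: "(\<lambda>x. (\<Sum>i\<in>insert i I. Z i x)\<^sup>2) = (\<lambda>x. (Z i x)\<^sup>2 + 2 * (Z i x * ?S x) + (?S x)\<^sup>2)"
    using insert.hyps by (auto simp: power2_sum algebra_simps)
  show ?case
    unfolding expand using IH mix Zi insert.hyps by simp
qed simp

lemma indicator_mgf_le:
  assumes "real_distribution P" "l > 0" "s = 1 \<or> s = (-1::real)"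
  shows "(\<integral>\<^sup>+x. ennreal (exp (l * (s * (indicator {..t} x - cdf P t)))) \<partial>P) \<le> ennreal (exp (l\<^sup>2 / 8))"
proof -
  interpret P: real_distribution P by fact
  \<comment> \<open>The lower end of the range of the signed centred indicator. The range has length
    1 for both signs, whence the constant 1/8 in Hoeffding's lemma.\<close>
  define a where "a = (if s = 1 then - cdf P t else cdf P t - 1)"
  interpret I: interval_bounded_random_variable P "\<lambda>x. s * (indicator {..t} x - cdf P t)" a "a + 1"
    by unfold_locales (use assms(3) in \<open>auto simp: a_def indicator_def\<close>)
  have "integrable P (indicator {..t} :: real \<Rightarrow> real)"
    by (simp add: P.emeasure_eq_measure)
  then have "P.expectation (\<lambda>x. s * (indicator {..t} x - cdf P t)) = 0"
    using P.prob_space by (simp add: cdf_def2)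
  from I.Hoeffdings_lemma_nn_integral_0[OF assms(2) this] show ?thesis by simp
qed

section \<open>The sample, its likelihood ratios and the test on the grid\<close>

locale iid_sample = prob_space M for M :: "'a measure" +
  fixes X :: "nat \<Rightarrow> 'a \<Rightarrow> real" and p0 :: "real \<Rightarrow> real"
  assumes p0: "prob_density p0"
    and indep: "indep_vars (\<lambda>_. borel) X {1..}"
    and distributed_X: "\<And>i. i \<ge> 1 \<Longrightarrow> distributed M lborel (X i) (\<lambda>x. ennreal (p0 x))"
begin

definition likelihood_ratio :: "nat \<Rightarrow> (real \<Rightarrow> real) \<Rightarrow> 'a \<Rightarrow> real" where
  "likelihood_ratio n q \<omega> = (\<Prod>i=1..n. q (X i \<omega>) / p0 (X i \<omega>))"

text \<open>The acceptance event of a Kolmogorov-Smirnov test restricted to a finite grid, written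
  with counts instead of frequencies. It does not involve \<open>q\<close>, so one event serves all
  alternatives.\<close>

definition grid_close :: "nat \<Rightarrow> real \<Rightarrow> 'a \<Rightarrow> bool" where
  "grid_close n d \<omega> \<longleftrightarrow>
     (\<forall>j\<le>n. \<bar>(\<Sum>i=1..n. indicator {..real j / real n} (X i \<omega>)) - real n * cdf (law p0) (real j / real n)\<bar>
        < real n * d)"

lemma p0_measurable [measurable]: "p0 \<in> borel_measurable borel"
  by (rule prob_densityD(1)[OF p0])

lemma X_measurable: "i \<ge> 1 \<Longrightarrow> X i \<in> borel_measurable M"
  using distributed_measurable[OF distributed_X] by simp

lemma measurable_sample: "g \<in> borel \<rightarrow>\<^sub>M N \<Longrightarrow> i \<ge> 1 \<Longrightarrow> (\<lambda>\<omega>. g (X i \<omega>)) \<in> M \<rightarrow>\<^sub>M N"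
  by (rule measurable_compose[OF X_measurable])

lemma distr_X: "i \<ge> 1 \<Longrightarrow> distr M borel (X i) = law p0"
  using distributed_distr_eq_density[OF distributed_X[of i]] unfolding law_def
  by (metis distr_cong sets_lborel)

lemma indep_sample:
  assumes "g \<in> borel_measurable borel"
  shows "indep_vars (\<lambda>_. borel) (\<lambda>i \<omega>. g (X i \<omega>)) {1..n}"
  by (rule indep_vars_compose2[OF indep_vars_subset[OF indep]]) (use assms in auto)

lemma nn_integral_sample_prod:
  fixes g :: "real \<Rightarrow> ennreal"
  assumes [measurable]: "g \<in> borel_measurable borel"
  shows "(\<integral>\<^sup>+\<omega>. (\<Prod>i=1..n. g (X i \<omega>)) \<partial>M) = (\<integral>\<^sup>+x. g x \<partial>law p0) ^ n"
proof -
  have "(\<integral>\<^sup>+\<omega>. g (X i \<omega>) \<partial>M) = (\<integral>\<^sup>+x. g x \<partial>law p0)" if "i \<ge> 1" for i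
    using that X_measurable[OF that] by (simp add: distr_X[symmetric] nn_integral_distr)
  then show ?thesis
    using indep_sample[OF assms, of n] by (subst indep_vars_nn_integral) simp_all
qed

text \<open>Only an inequality, since \<open>q\<close> may charge the set where \<open>p0\<close> vanishes.\<close>

lemma nn_integral_likelihood_tilt_le:
  assumes q: "prob_density q" and [measurable]: "h \<in> borel_measurable borel"
  shows "(\<integral>\<^sup>+\<omega>. (\<Prod>i=1..n. ennreal (q (X i \<omega>) / p0 (X i \<omega>)) * h (X i \<omega>)) \<partial>M)
    \<le> (\<integral>\<^sup>+x. h x \<partial>law q) ^ n"
proof -
  note [measurable] = prob_densityD(1)[OF q]
  \<comment> \<open>Equality where \<open>p0\<close> is positive; where \<open>p0\<close> vanishes,
    the left side is 0.\<close>
  have *: "ennreal (p0 x) * ennreal (q x / p0 x) \<le> ennreal (q x)" for x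
    using prob_densityD(2)[OF q, of x] prob_densityD(2)[OF p0, of x]
    by (cases "p0 x = 0") (auto simp flip: ennreal_mult)
  have "(\<integral>\<^sup>+x. ennreal (q x / p0 x) * h x \<partial>law p0)
      = (\<integral>\<^sup>+x. ennreal (p0 x) * ennreal (q x / p0 x) * h x \<partial>lborel)"
    unfolding law_def by (subst nn_integral_density) (auto simp: mult.assoc)
  also have "\<dots> \<le> (\<integral>\<^sup>+x. ennreal (q x) * h x \<partial>lborel)"
    by (intro nn_integral_mono mult_right_mono *) auto
  also have "\<dots> = (\<integral>\<^sup>+x. h x \<partial>law q)"
    unfolding law_def by (subst nn_integral_density) auto
  finally show ?thesis
    by (subst nn_integral_sample_prod[where g = "\<lambda>x. ennreal (q x / p0 x) * h x"])
       (auto intro: power_mono)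
qed

lemma likelihood_ratio_nonneg: "prob_density q \<Longrightarrow> 0 \<le> likelihood_ratio n q \<omega>"
  unfolding likelihood_ratio_def
  by (intro prod_nonneg) (auto simp: prob_densityD(2) p0)

lemma likelihood_ratio_measurable:
  "q \<in> borel_measurable borel \<Longrightarrow> likelihood_ratio n q \<in> borel_measurable M"
  unfolding likelihood_ratio_def
  by (intro borel_measurable_prod measurable_sample) auto

lemma ennreal_likelihood_ratio:
  "prob_density q \<Longrightarrow>
     ennreal (likelihood_ratio n q \<omega>) = (\<Prod>i=1..n. ennreal (q (X i \<omega>) / p0 (X i \<omega>)))"
  unfolding likelihood_ratio_def
  by (intro prod_ennreal[symmetric]) (auto simp: prob_densityD(2) p0)

lemma nn_integral_likelihood_ratio_le_1:
  assumes "prob_density q"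
  shows "(\<integral>\<^sup>+\<omega>. ennreal (likelihood_ratio n q \<omega>) \<partial>M) \<le> 1"
proof -
  interpret q: real_distribution "law q" by (rule real_distribution_law[OF assms])
  show ?thesis
    using nn_integral_likelihood_tilt_le[OF assms, of "\<lambda>_. 1" n] q.emeasure_space_1
    by (simp add: ennreal_likelihood_ratio[OF assms])
qed

lemma count_measurable [measurable]:
  "(\<lambda>\<omega>. \<Sum>i=1..n. indicator {..t::real} (X i \<omega>) :: real) \<in> borel_measurable M"
  by (intro borel_measurable_sum measurable_sample) auto

lemma grid_close_measurable [measurable]: "Measurable.pred M (grid_close n d)"
  unfolding grid_close_def by measurable

lemma expectation_indicator_sample:
  assumes i: "i \<ge> 1"
  shows "expectation (\<lambda>\<omega>. indicator {..t} (X i \<omega>) :: real) = cdf (law p0) t"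
proof -
  have "expectation (\<lambda>\<omega>. indicator {..t} (X i \<omega>) :: real) = (LINT x|distr M borel (X i). indicator {..t} x)"
    by (rule integral_distr[symmetric, OF X_measurable[OF i]]) simp
  then show ?thesis by (simp add: distr_X[OF i] cdf_def2)
qed

text \<open>Hoeffding's inequality at each of the \<open>n + 1\<close> grid points, followed by a
  union bound.\<close>

lemma prob_not_grid_close_le:
  assumes "n > 0" "d \<ge> 0"
  shows "prob {\<omega> \<in> space M. \<not> grid_close n d \<omega>} \<le> 2 * (real n + 1) * exp (- 2 * real n * d\<^sup>2)"
proof -
  let ?S = "\<lambda>t \<omega>. (\<Sum>i=1..n. indicator {..t} (X i \<omega>)) :: real"
  have dev: "prob {\<omega> \<in> space M. \<bar>?S t \<omega> - real n * cdf (law p0) t\<bar> \<ge> real n * d}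
      \<le> 2 * exp (- 2 * real n * d\<^sup>2)" for t
  proof -
    interpret H: Hoeffding_ineq M "{1..n}" "\<lambda>i \<omega>. indicator {..t} (X i \<omega>) :: real" "\<lambda>_. 0" "\<lambda>_. 1"
      "\<Sum>i=1..n. expectation (\<lambda>\<omega>. indicator {..t} (X i \<omega>))"
    proof unfold_locales
      show "indep_vars (\<lambda>_. borel) (\<lambda>i \<omega>. indicator {..t} (X i \<omega>) :: real) {1..n}"
        by (rule indep_sample) simp
    qed (auto simp: indicator_def)
    have mean: "(\<Sum>i=1..n. expectation (\<lambda>\<omega>. indicator {..t} (X i \<omega>) :: real)) = real n * cdf (law p0) t"
      by (simp add: expectation_indicator_sample)
    have "prob {\<omega> \<in> space M. \<bar>?S t \<omega> - real n * cdf (law p0) t\<bar> \<ge> real n * d}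
        \<le> 2 * exp (- 2 * (real n * d)\<^sup>2 / (\<Sum>i=1..n. (1 - 0)\<^sup>2))"
      unfolding mean[symmetric] using assms by (intro H.Hoeffding_ineq_abs_ge) auto
    also have "- 2 * (real n * d)\<^sup>2 / (\<Sum>i=1..n. (1 - 0)\<^sup>2) = - 2 * real n * d\<^sup>2"
      using assms by (simp add: power2_eq_square)
    finally show ?thesis .
  qed
  let ?E = "\<lambda>j. {\<omega> \<in> space M.
      \<bar>?S (real j / real n) \<omega> - real n * cdf (law p0) (real j / real n)\<bar> \<ge> real n * d}"
  have "{\<omega> \<in> space M. \<not> grid_close n d \<omega>} = (\<Union>j\<in>{..n}. ?E j)"
    by (auto simp: grid_close_def not_less)
  then have "prob {\<omega> \<in> space M. \<not> grid_close n d \<omega>} = prob (\<Union>j\<in>{..n}. ?E j)"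
    by (rule arg_cong)
  also have "\<dots> \<le> (\<Sum>j\<in>{..n}. prob (?E j))"
    by (intro finite_measure_subadditive_finite) (auto simp del: One_nat_def)
  also have "\<dots> \<le> (\<Sum>j\<in>{..n}. 2 * exp (- 2 * real n * d\<^sup>2))"
    by (intro sum_mono dev)
  also have "\<dots> = 2 * (real n + 1) * exp (- 2 * real n * d\<^sup>2)"
    by simp
  finally show ?thesis .
qed

text \<open>On the event \<open>grid_close n d\<close> the empirical distribution function is at distance more than \<open>d\<close>
  from that of \<open>q\<close>, so its indicator is dominated by an exponential that factorizes over the sample.\<close>

lemma nn_integral_likelihood_ratio_grid_close_le:
  assumes q: "prob_density q" and "n > 0" "d > 0" "j \<le> n"
    and gap: "\<bar>cdf (law q) (real j / real n) - cdf (law p0) (real j / real n)\<bar> > 2 * d"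
  shows "(\<integral>\<^sup>+\<omega>. ennreal (likelihood_ratio n q \<omega>) * indicator {\<omega>. grid_close n d \<omega>} \<omega> \<partial>M)
    \<le> ennreal (exp (- 2 * real n * d\<^sup>2))"
proof -
  define t where "t = real j / real n"
  \<comment> \<open>The sign orients the gap: \<open>s * (cdf (law p0) t - cdf (law q) t)\<close>
    exceeds \<open>2 * d\<close>.\<close>
  define s :: real where "s = (if cdf (law q) t > cdf (law p0) t then - 1 else 1)"
  \<comment> \<open>The minimizer of the final exponent
    \<open>- l * n * d + n * l^2 / 8\<close>.\<close>
  define l where "l = 4 * d"
  define h where "h = (\<lambda>x. exp (l * (s * (indicator {..t} x - cdf (law q) t))))"
  have [measurable]: "h \<in> borel_measurable borel" unfolding h_def by simp
  have q': "real_distribution (law q)" by (rule real_distribution_law[OF q])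
  have dom: "indicator {\<omega>. grid_close n d \<omega>} \<omega> \<le> ennreal (exp (- (l * (real n * d)))) * (\<Prod>i=1..n. ennreal (h (X i \<omega>)))"
    for \<omega>
  proof (cases "grid_close n d \<omega>")
    case True
    define S :: real where "S = (\<Sum>i=1..n. indicator {..t} (X i \<omega>))"
    have S: "\<bar>S - real n * cdf (law p0) t\<bar> < real n * d"
      using True \<open>j \<le> n\<close> unfolding grid_close_def S_def t_def by blast
    \<comment> \<open>Closeness of the count to its mean under \<open>p0\<close> uses up
      \<open>n * d\<close> of the gap \<open>2 * n * d\<close>; the other \<open>n * d\<close>
      remains as a deviation from the mean under \<open>q\<close>.\<close>
    have "real n * (2 * d) < real n * \<bar>cdf (law q) t - cdf (law p0) t\<bar>"
      using gap \<open>n > 0\<close> unfolding t_def by (intro mult_strict_left_mono) auto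
    with S have "real n * d \<le> s * (S - real n * cdf (law q) t)"
      by (auto simp: s_def abs_if algebra_simps split: if_splits)
    then have "l * (real n * d) \<le> l * (s * (S - real n * cdf (law q) t))"
      using \<open>d > 0\<close> unfolding l_def by (intro mult_left_mono) auto
    also have "\<dots> = (\<Sum>i=1..n. l * (s * (indicator {..t} (X i \<omega>) - cdf (law q) t)))"
      unfolding S_def by (simp add: sum_subtractf flip: sum_distrib_left)
    finally have "1 \<le> exp (- (l * (real n * d))) * (\<Prod>i=1..n. h (X i \<omega>))"
      unfolding h_def by (simp add: exp_sum[symmetric] exp_add[symmetric])
    then have "ennreal 1 \<le> ennreal (exp (- (l * (real n * d))) * (\<Prod>i=1..n. h (X i \<omega>)))"
      by (rule ennreal_leI)
    then show ?thesis
      using True by (simp add: ennreal_mult' prod_ennreal h_def)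
  qed simp
  have "(\<integral>\<^sup>+\<omega>. ennreal (likelihood_ratio n q \<omega>) * indicator {\<omega>. grid_close n d \<omega>} \<omega> \<partial>M)
    \<le> (\<integral>\<^sup>+\<omega>. ennreal (exp (- (l * (real n * d)))) *
        (\<Prod>i=1..n. ennreal (q (X i \<omega>) / p0 (X i \<omega>)) * ennreal (h (X i \<omega>))) \<partial>M)"
  proof (rule nn_integral_mono)
    fix \<omega>
    show "ennreal (likelihood_ratio n q \<omega>) * indicator {\<omega>. grid_close n d \<omega>} \<omega> \<le>
        ennreal (exp (- (l * (real n * d)))) *
        (\<Prod>i=1..n. ennreal (q (X i \<omega>) / p0 (X i \<omega>)) * ennreal (h (X i \<omega>)))"
      using mult_left_mono[OF dom[of \<omega>], of "\<Prod>i=1..n. ennreal (q (X i \<omega>) / p0 (X i \<omega>))"]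
      by (simp add: ennreal_likelihood_ratio[OF q] prod.distrib mult_ac)
  qed
  also have "\<dots> = ennreal (exp (- (l * (real n * d)))) *
      (\<integral>\<^sup>+\<omega>. (\<Prod>i=1..n. ennreal (q (X i \<omega>) / p0 (X i \<omega>)) * ennreal (h (X i \<omega>))) \<partial>M)"
    using prob_densityD(1)[OF q]
    by (intro nn_integral_cmult borel_measurable_prod_ennreal measurable_sample) auto
  also have "\<dots> \<le> ennreal (exp (- (l * (real n * d)))) * (\<integral>\<^sup>+x. ennreal (h x) \<partial>law q) ^ n"
    by (intro mult_left_mono nn_integral_likelihood_tilt_le[OF q]) auto
  also have "\<dots> \<le> ennreal (exp (- (l * (real n * d)))) * ennreal (exp (l\<^sup>2 / 8)) ^ n"
    unfolding h_def using \<open>d > 0\<close>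
    by (intro mult_left_mono power_mono indicator_mgf_le[OF q']) (auto simp: l_def s_def)
  also have "\<dots> = ennreal (exp (- (l * (real n * d)) + real n * (l\<^sup>2 / 8)))"
    by (simp add: ennreal_power exp_of_nat_mult[symmetric] flip: ennreal_mult exp_add)
  also have "- (l * (real n * d)) + real n * (l\<^sup>2 / 8) = - 2 * real n * d\<^sup>2"
    by (simp add: l_def power2_eq_square)
  finally show ?thesis .
qed

text \<open>The negative log-likelihood ratio is a sum of \<open>n\<close> independent terms, with
  total mean and variance at most \<open>n * e^2\<close>. Exceeding \<open>2 * n * e^2\<close> is
  thus a deviation of at least \<open>n * e^2\<close>, and Chebyshev's inequality applies.\<close>

lemma prob_likelihood_ratio_small_le:
  assumes q: "prob_density q" and pos: "AE x in law p0. 0 < q x"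
    and int1: "integrable (law p0) (\<lambda>x. ln (p0 x / q x))"
    and int2: "integrable (law p0) (\<lambda>x. (ln (p0 x / q x))\<^sup>2)"
    and le1: "(LINT x|law p0. ln (p0 x / q x)) \<le> e\<^sup>2"
    and le2: "(LINT x|law p0. (ln (p0 x / q x))\<^sup>2) \<le> e\<^sup>2"
    and "n > 0" "e > 0"
  shows "prob {\<omega> \<in> space M. likelihood_ratio n q \<omega> < exp (- 2 * real n * e\<^sup>2)} \<le> 1 / (real n * e\<^sup>2)"
proof -
  note [measurable] = prob_densityD(1)[OF q]
  interpret p0: real_distribution "law p0" by (rule real_distribution_law[OF p0])
  define m where "m = (LINT x|law p0. ln (p0 x / q x))"
  define g where "g = (\<lambda>x. ln (p0 x / q x) - m)"
  have [measurable]: "g \<in> borel_measurable borel" unfolding g_def by measurable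
  have g: "integrable (law p0) g" "integrable (law p0) (\<lambda>x. (g x)\<^sup>2)" "(LINT x|law p0. g x) = 0"
    using int1 int2 p0.prob_space unfolding g_def power2_diff by (simp_all add: m_def)
  have "(LINT x|law p0. (g x)\<^sup>2) = (LINT x|law p0. (ln (p0 x / q x))\<^sup>2) - m\<^sup>2"
    using p0.variance_eq[OF int1 int2] by (simp add: g_def m_def)
  then have g2: "(LINT x|law p0. (g x)\<^sup>2) \<le> e\<^sup>2"
    using le2 by (smt (verit) zero_le_power2)
  have tr: "integrable M (\<lambda>\<omega>. f (X i \<omega>)) \<longleftrightarrow> integrable (law p0) f"
    "(LINT \<omega>|M. f (X i \<omega>)) = (LINT x|law p0. f x)"
    if "i \<ge> 1" "f \<in> borel_measurable borel" for i and f :: "real \<Rightarrow> real"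
    unfolding distr_X[OF that(1), symmetric]
    using that X_measurable[of i] by (simp_all add: integrable_distr_eq integral_distr)
  have gX: "integrable M (\<lambda>\<omega>. g (X i \<omega>))" "integrable M (\<lambda>\<omega>. (g (X i \<omega>))\<^sup>2)"
    "expectation (\<lambda>\<omega>. g (X i \<omega>)) = 0" "expectation (\<lambda>\<omega>. (g (X i \<omega>))\<^sup>2) \<le> e\<^sup>2"
    if "i \<in> {1..n}" for i
    using that g g2 tr[of i g] tr[of i "\<lambda>x. (g x)\<^sup>2"] by auto
  let ?S = "\<lambda>\<omega>. \<Sum>i=1..n. g (X i \<omega>)"
  have S2: "integrable M (\<lambda>\<omega>. (?S \<omega>)\<^sup>2)"
    "expectation (\<lambda>\<omega>. (?S \<omega>)\<^sup>2) = (\<Sum>i=1..n. expectation (\<lambda>\<omega>. (g (X i \<omega>))\<^sup>2))"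
    using sum_indep_centered_second_moment[OF finite_atLeastAtMost indep_sample[of g n] gX(1-3)] by simp_all
  have ES2: "expectation (\<lambda>\<omega>. (?S \<omega>)\<^sup>2) \<le> real n * e\<^sup>2"
    unfolding S2(2) using sum_bounded_above[of "{1..n}", OF gX(4)] by simp
  \<comment> \<open>Both densities must be positive at the data for \<open>exp\<close> to undo
    \<open>ln\<close>; hence the comparison of events below holds only almost surely.\<close>
  have AEpos: "AE \<omega> in M. 0 < q (X i \<omega>) \<and> 0 < p0 (X i \<omega>)" if "i \<in> {1..n}" for i
  proof -
    have "AE x in law p0. 0 < p0 x"
      unfolding law_def by (subst AE_density) auto
    with pos have "AE x in distr M borel (X i). 0 < q x \<and> 0 < p0 x"
      using that by (subst distr_X) auto
    then show ?thesis
      using that by (subst (asm) AE_distr_iff) (auto intro: X_measurable)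
  qed
  have "AE \<omega> in M. \<forall>i\<in>{1..n}. 0 < q (X i \<omega>) \<and> 0 < p0 (X i \<omega>)"
    using AEpos by (intro AE_finite_allI) auto
  then have AE_le: "AE \<omega> in M. likelihood_ratio n q \<omega> < exp (- 2 * real n * e\<^sup>2) \<longrightarrow> (real n * e\<^sup>2)\<^sup>2 \<le> (?S \<omega>)\<^sup>2"
  proof eventually_elim
    case (elim \<omega>)
    show ?case
    proof
      assume small: "likelihood_ratio n q \<omega> < exp (- 2 * real n * e\<^sup>2)"
      have "likelihood_ratio n q \<omega> = (\<Prod>i=1..n. exp (- ln (p0 (X i \<omega>) / q (X i \<omega>))))"
        unfolding likelihood_ratio_def using elim
        by (intro prod.cong) (auto simp: exp_minus)
      also have "\<dots> = exp (- (\<Sum>i=1..n. ln (p0 (X i \<omega>) / q (X i \<omega>))))"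
        unfolding sum_negf[symmetric] by (rule exp_sum[symmetric]) simp
      also have "(\<Sum>i=1..n. ln (p0 (X i \<omega>) / q (X i \<omega>))) = ?S \<omega> + real n * m"
        by (simp add: g_def sum_subtractf)
      finally have "2 * real n * e\<^sup>2 < ?S \<omega> + real n * m"
        using small by simp
      moreover have "real n * m \<le> real n * e\<^sup>2"
        using le1 by (simp add: m_def mult_left_mono)
      ultimately show "(real n * e\<^sup>2)\<^sup>2 \<le> (?S \<omega>)\<^sup>2"
        by (intro power_mono) auto
    qed
  qed
  have [measurable]: "?S \<in> borel_measurable M"
    by (intro borel_measurable_sum measurable_sample) auto
  have [measurable]: "likelihood_ratio n q \<in> borel_measurable M"
    by (rule likelihood_ratio_measurable[OF prob_densityD(1)[OF q]])
  have "prob {\<omega> \<in> space M. likelihood_ratio n q \<omega> < exp (- 2 * real n * e\<^sup>2)}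
      \<le> prob {\<omega> \<in> space M. (real n * e\<^sup>2)\<^sup>2 \<le> (?S \<omega>)\<^sup>2}"
    using AE_le by (intro finite_measure_mono_AE) (auto simp del: One_nat_def)
  also have "\<dots> \<le> expectation (\<lambda>\<omega>. (?S \<omega>)\<^sup>2) / (real n * e\<^sup>2)\<^sup>2"
    using \<open>n > 0\<close> \<open>e > 0\<close> by (intro integral_Markov_inequality_measure[where A = "space M"] S2) auto
  also have "\<dots> \<le> real n * e\<^sup>2 / (real n * e\<^sup>2)\<^sup>2"
    using ES2 by (rule divide_right_mono) simp
  also have "\<dots> = 1 / (real n * e\<^sup>2)"
    by (simp add: power2_eq_square)
  finally show ?thesis .
qed

end

subsection \<open>Posterior tail bound\<close>

text \<open>Joint measurability of evaluation makes the likelihood ratio measurable in data and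
  density together, which is what Fubini's theorem requires.\<close>

locale posterior_model = iid_sample M X p0 + Prior: prob_space Prior
  for M :: "'a measure" and X p0 and Prior :: "(real \<Rightarrow> real) measure" +
  assumes eval_measurable: "(\<lambda>(q, x). q x) \<in> borel_measurable (Prior \<Otimes>\<^sub>M borel)"
    and prob_density_Prior: "\<And>q. q \<in> space Prior \<Longrightarrow> prob_density q"
begin

sublocale pair_sigma_finite M Prior ..

lemma likelihood_ratio_pair_measurable [measurable]:
  "(\<lambda>(\<omega>, q). likelihood_ratio n q \<omega>) \<in> borel_measurable (M \<Otimes>\<^sub>M Prior)"
proof -
  have "(\<lambda>z. snd z (X i (fst z)) / p0 (X i (fst z))) \<in> borel_measurable (M \<Otimes>\<^sub>M Prior)"
    if "i \<in> {1..n}" for i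
  proof -
    have [measurable]: "X i \<in> borel_measurable M"
      using that by (intro X_measurable) auto
    have "(\<lambda>z. (snd z, X i (fst z))) \<in> M \<Otimes>\<^sub>M Prior \<rightarrow>\<^sub>M Prior \<Otimes>\<^sub>M borel"
      by measurable
    from measurable_compose[OF this eval_measurable]
    have [measurable]: "(\<lambda>z. snd z (X i (fst z))) \<in> borel_measurable (M \<Otimes>\<^sub>M Prior)"
      by simp
    show ?thesis by measurable
  qed
  then show ?thesis
    unfolding likelihood_ratio_def split_beta' by (rule borel_measurable_prod)
qed

lemma likelihood_ratio_section_measurable:
  "\<omega> \<in> space M \<Longrightarrow> (\<lambda>q. likelihood_ratio n q \<omega>) \<in> borel_measurable Prior"
  using measurable_compose[OF measurable_Pair1' likelihood_ratio_pair_measurable] by simp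

lemma posterior_eq:
  "posterior Prior p0 n (\<lambda>i. X i \<omega>) A =
     (LINT q:A|Prior. likelihood_ratio n q \<omega>) / (LINT q|Prior. likelihood_ratio n q \<omega>)"
  by (simp add: posterior_def likelihood_ratio_def)

lemma posterior_measurable:
  assumes [measurable]: "A \<in> sets Prior"
  shows "(\<lambda>\<omega>. posterior Prior p0 n (\<lambda>i. X i \<omega>) A) \<in> borel_measurable M"
proof -
  have "(\<lambda>(\<omega>, q). indicator A q *\<^sub>R likelihood_ratio n q \<omega>) \<in> borel_measurable (M \<Otimes>\<^sub>M Prior)"
    by measurable
  then show ?thesis
    unfolding posterior_eq set_lebesgue_integral_def
    by (rule borel_measurable_divide[OF Prior.borel_measurable_lebesgue_integral
          Prior.borel_measurable_lebesgue_integral]) (rule likelihood_ratio_pair_measurable)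
qed

text \<open>Let \<open>B\<close> be the prior mass of those \<open>q\<close> in \<open>N\<close>
  whose likelihood ratio is below \<open>a\<close>. Its expectation is at most \<open>b\<close>
  times the mass of \<open>N\<close> by Fubini. A small evidence forces \<open>B\<close> to be at
  least half the mass of \<open>N\<close>, and Markov's inequality yields the factor 2.\<close>

lemma prob_evidence_small_le:
  assumes N [measurable]: "N \<in> sets Prior" and "measure Prior N > 0" "a > 0" "b \<ge> 0"
    and small: "\<And>q. q \<in> N \<Longrightarrow> prob {\<omega> \<in> space M. likelihood_ratio n q \<omega> < a} \<le> b"
  shows "prob {\<omega> \<in> space M. (\<integral>\<^sup>+q\<in>N. ennreal (likelihood_ratio n q \<omega>) \<partial>Prior)
      < ennreal (a * measure Prior N / 2)} \<le> 2 * b"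
proof -
  define p where "p = measure Prior N"
  have p: "p > 0" "emeasure Prior N = ennreal p"
    using assms by (auto simp: p_def Prior.emeasure_eq_measure)
  define f :: "'a \<Rightarrow> (real \<Rightarrow> real) \<Rightarrow> ennreal" where
    "f = (\<lambda>\<omega> q. if q \<in> N \<and> likelihood_ratio n q \<omega> < a then 1 else 0)"
  have f [measurable]: "case_prod f \<in> borel_measurable (M \<Otimes>\<^sub>M Prior)"
    unfolding f_def by measurable
  define B where "B = (\<lambda>\<omega>. \<integral>\<^sup>+q. f \<omega> q \<partial>Prior)"
  have [measurable]: "B \<in> borel_measurable M"
    unfolding B_def by measurable
  have "(\<integral>\<^sup>+\<omega>. B \<omega> \<partial>M) = (\<integral>\<^sup>+q. (\<integral>\<^sup>+\<omega>. f \<omega> q \<partial>M) \<partial>Prior)"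
    unfolding B_def by (rule Fubini'[OF f, symmetric])
  also have "\<dots> \<le> (\<integral>\<^sup>+q. ennreal b * indicator N q \<partial>Prior)"
  proof (rule nn_integral_mono)
    fix q assume q: "q \<in> space Prior"
    have [measurable]: "likelihood_ratio n q \<in> borel_measurable M"
      by (intro likelihood_ratio_measurable prob_densityD(1) prob_density_Prior q)
    have "(\<integral>\<^sup>+\<omega>. f \<omega> q \<partial>M) =
        (\<integral>\<^sup>+\<omega>. indicator {\<omega> \<in> space M. likelihood_ratio n q \<omega> < a} \<omega> * indicator N q \<partial>M)"
      by (intro nn_integral_cong) (auto simp: f_def indicator_def)
    also have "\<dots> = ennreal (prob {\<omega> \<in> space M. likelihood_ratio n q \<omega> < a}) * indicator N q"
      by (simp add: nn_integral_multc emeasure_eq_measure)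
    also have "\<dots> \<le> ennreal b * indicator N q"
      using small[of q] by (auto simp: indicator_def intro: ennreal_leI)
    finally show "(\<integral>\<^sup>+\<omega>. f \<omega> q \<partial>M) \<le> ennreal b * indicator N q" .
  qed
  also have "\<dots> = ennreal (b * p)"
    using p \<open>b \<ge> 0\<close> by (simp add: nn_integral_cmult_indicator ennreal_mult)
  finally have EB: "(\<integral>\<^sup>+\<omega>. B \<omega> \<partial>M) \<le> ennreal (b * p)" .
  have "1 \<le> ennreal (2 / p) * B \<omega>"
    if \<omega>: "\<omega> \<in> space M" and less: "(\<integral>\<^sup>+q\<in>N. ennreal (likelihood_ratio n q \<omega>) \<partial>Prior) < ennreal (a * p / 2)" for \<omega>
  proof -
    note [measurable] = likelihood_ratio_section_measurable[OF \<omega>]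
    have fm: "f \<omega> \<in> borel_measurable Prior"
      unfolding f_def by measurable
    have "ennreal (a * p) = (\<integral>\<^sup>+q. ennreal a * indicator N q \<partial>Prior)"
      using p \<open>a > 0\<close> by (simp add: nn_integral_cmult_indicator ennreal_mult)
    \<comment> \<open>Pointwise on \<open>N\<close>, either the likelihood ratio is at least
      \<open>a\<close> or \<open>f\<close> equals 1.\<close>
    also have "\<dots> \<le> (\<integral>\<^sup>+q. ennreal (likelihood_ratio n q \<omega>) * indicator N q + ennreal a * f \<omega> q \<partial>Prior)"
      by (intro nn_integral_mono) (auto simp: f_def indicator_def intro: ennreal_leI)
    also have "\<dots> = (\<integral>\<^sup>+q\<in>N. ennreal (likelihood_ratio n q \<omega>) \<partial>Prior) + ennreal a * B \<omega>"
      unfolding B_def using fm by (subst nn_integral_add) (auto simp: nn_integral_cmult)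
    also have "\<dots> \<le> ennreal (a * p / 2) + ennreal a * B \<omega>"
      using less by (intro add_right_mono) simp
    finally have *: "ennreal (a * p) \<le> ennreal (a * p / 2) + ennreal a * B \<omega>" .
    show ?thesis
    proof (cases "B \<omega>")
      case (real r)
      then have "a * p \<le> a * p / 2 + a * r"
        using * \<open>a > 0\<close> p by (simp flip: ennreal_mult ennreal_plus)
      then have "a * p \<le> a * (2 * r)" by simp
      then have "1 \<le> 2 / p * r"
        using \<open>a > 0\<close> p by (simp add: field_simps)
      then show ?thesis
        using real p by (simp flip: ennreal_mult ennreal_1)
    qed (use p in \<open>simp add: ennreal_mult_top\<close>)
  qed
  then have "emeasure M {\<omega> \<in> space M. (\<integral>\<^sup>+q\<in>N. ennreal (likelihood_ratio n q \<omega>) \<partial>Prior) < ennreal (a * p / 2)}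
      \<le> emeasure M {\<omega> \<in> space M. 1 \<le> ennreal (2 / p) * B \<omega>}"
    by (intro emeasure_mono) auto
  also have "\<dots> \<le> ennreal (2 / p) * (\<integral>\<^sup>+\<omega>. B \<omega> * indicator (space M) \<omega> \<partial>M)"
    by (rule nn_integral_Markov_inequality) auto
  also have "\<dots> \<le> ennreal (2 / p) * ennreal (b * p)"
    using EB by (intro mult_left_mono) (auto simp: nn_integral_set_ennreal cong: nn_integral_cong)
  also have "\<dots> = ennreal (2 * b)"
    using p \<open>b \<ge> 0\<close> by (simp flip: ennreal_mult)
  finally show ?thesis
    using \<open>b \<ge> 0\<close> by (simp add: emeasure_eq_measure p_def)
qed

text \<open>By Fubini, a bound for each single density survives averaging, as the prior has total
  mass one.\<close>

lemma nn_integral_numerator_le: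
  assumes [measurable]: "A \<in> sets Prior" "Measurable.pred M G"
    and le: "\<And>q. q \<in> A \<Longrightarrow> (\<integral>\<^sup>+\<omega>. ennreal (likelihood_ratio n q \<omega>) * indicator {\<omega>. G \<omega>} \<omega> \<partial>M) \<le> v"
  shows "(\<integral>\<^sup>+\<omega>. (\<integral>\<^sup>+q\<in>A. ennreal (likelihood_ratio n q \<omega>) \<partial>Prior) * indicator {\<omega>. G \<omega>} \<omega> \<partial>M) \<le> v"
proof -
  have "(\<integral>\<^sup>+\<omega>. (\<integral>\<^sup>+q\<in>A. ennreal (likelihood_ratio n q \<omega>) \<partial>Prior) * indicator {\<omega>. G \<omega>} \<omega> \<partial>M)
     = (\<integral>\<^sup>+\<omega>. (\<integral>\<^sup>+q. ennreal (likelihood_ratio n q \<omega>) * indicator A q * indicator {\<omega>. G \<omega>} \<omega> \<partial>Prior) \<partial>M)"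
    by (intro nn_integral_cong nn_integral_multc[symmetric] borel_measurable_times_ennreal
        measurable_compose[OF _ measurable_ennreal] likelihood_ratio_section_measurable) auto
  also have "\<dots> = (\<integral>\<^sup>+q. (\<integral>\<^sup>+\<omega>. ennreal (likelihood_ratio n q \<omega>) * indicator A q * indicator {\<omega>. G \<omega>} \<omega> \<partial>M) \<partial>Prior)"
    by (rule Fubini'[symmetric]) measurable
  also have "\<dots> \<le> (\<integral>\<^sup>+q. v \<partial>Prior)"
  proof (rule nn_integral_mono)
    fix q
    show "(\<integral>\<^sup>+\<omega>. ennreal (likelihood_ratio n q \<omega>) * indicator A q * indicator {\<omega>. G \<omega>} \<omega> \<partial>M) \<le> v"
      using le[of q] by (cases "q \<in> A") auto
  qed
  also have "\<dots> = v"
    by (simp add: Prior.emeasure_space_1)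
  finally show ?thesis .
qed

text \<open>The evidence has expectation at most 1. Finiteness lets the Bochner integrals in
  \<open>posterior\<close>, which default to 0 without integrability, be identified with nonnegative
  integrals.\<close>

lemma AE_evidence_finite: "AE \<omega> in M. (\<integral>\<^sup>+q. ennreal (likelihood_ratio n q \<omega>) \<partial>Prior) < \<infinity>"
proof -
  have "(\<integral>\<^sup>+\<omega>. (\<integral>\<^sup>+q\<in>space Prior. ennreal (likelihood_ratio n q \<omega>) \<partial>Prior) * indicator {\<omega>. True} \<omega> \<partial>M) \<le> 1"
    by (rule nn_integral_numerator_le)
       (auto intro: nn_integral_likelihood_ratio_le_1 prob_density_Prior)
  then have "(\<integral>\<^sup>+\<omega>. (\<integral>\<^sup>+q. ennreal (likelihood_ratio n q \<omega>) \<partial>Prior) \<partial>M) \<noteq> \<infinity>"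
    by (auto simp: nn_integral_set_ennreal top_unique cong: nn_integral_cong)
  from nn_integral_PInf_AE[OF _ this] show ?thesis
    by (simp add: less_top)
qed

text \<open>Three exceptional events give the three summands: \<open>G\<close> fails, the evidence
  is small, or the numerator is large although \<open>G\<close> holds. Off them the quotient stays
  below \<open>\<eta>\<close>. The set \<open>T\<close> of full prior mass lets the numerator bound
  be checked only there.\<close>

lemma prob_posterior_gt_le:
  assumes [measurable]: "A \<in> sets Prior" "N \<in> sets Prior" "Measurable.pred M G"
    and T: "AE q in Prior. q \<in> T" "T \<in> sets Prior"
    and "measure Prior N > 0" "a > 0" "b \<ge> 0" "v \<ge> 0" "\<eta> > 0"
    and N: "\<And>q. q \<in> N \<Longrightarrow> prob {\<omega> \<in> space M. likelihood_ratio n q \<omega> < a} \<le> b"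
    and A: "\<And>q. q \<in> A \<Longrightarrow> q \<in> T \<Longrightarrow>
      (\<integral>\<^sup>+\<omega>. ennreal (likelihood_ratio n q \<omega>) * indicator {\<omega>. G \<omega>} \<omega> \<partial>M) \<le> ennreal v"
  shows "prob {\<omega> \<in> space M. \<bar>posterior Prior p0 n (\<lambda>i. X i \<omega>) A\<bar> > \<eta>}
    \<le> prob {\<omega> \<in> space M. \<not> G \<omega>} + 2 * b + 2 * v / (\<eta> * a * measure Prior N)"
proof -
  note [measurable] = T(2)
  define r where "r = a * measure Prior N / 2"
  have r: "r > 0" using assms by (simp add: r_def)
  let ?num = "\<lambda>A \<omega>. \<integral>\<^sup>+q\<in>A. ennreal (likelihood_ratio n q \<omega>) \<partial>Prior"
  let ?E1 = "{\<omega> \<in> space M. \<not> G \<omega>}"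
  let ?E2 = "{\<omega> \<in> space M. ?num N \<omega> < ennreal r}"
  \<comment> \<open>The event that the numerator reaches \<open>\<eta> * r\<close> on
    \<open>G\<close>, scaled to the form of Markov's inequality.\<close>
  let ?E3 = "{\<omega> \<in> space M. 1 \<le> ennreal (1 / (\<eta> * r)) * (?num (A \<inter> T) \<omega> * indicator {\<omega>. G \<omega>} \<omega>)}"
  have num_meas [measurable]: "?num B \<in> borel_measurable M" if [measurable]: "B \<in> sets Prior" for B
    by measurable
  have "emeasure M ?E3 \<le> ennreal (1 / (\<eta> * r)) *
      (\<integral>\<^sup>+\<omega>. ?num (A \<inter> T) \<omega> * indicator {\<omega>. G \<omega>} \<omega> * indicator (space M) \<omega> \<partial>M)"
    by (rule nn_integral_Markov_inequality) auto
  also have "\<dots> = ennreal (1 / (\<eta> * r)) *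
      (\<integral>\<^sup>+\<omega>. ?num (A \<inter> T) \<omega> * indicator {\<omega>. G \<omega>} \<omega> \<partial>M)"
    by (rule arg_cong[where f = "(*) (ennreal (1 / (\<eta> * r)))"], rule nn_integral_cong) simp
  also have "\<dots> \<le> ennreal (1 / (\<eta> * r)) * ennreal v"
    using A by (intro mult_left_mono nn_integral_numerator_le) auto
  also have "\<dots> = ennreal (v / (\<eta> * r))"
    using r assms by (simp flip: ennreal_mult)
  finally have E3: "prob ?E3 \<le> v / (\<eta> * r)"
    using r assms by (simp add: emeasure_eq_measure)
  have E2: "prob ?E2 \<le> 2 * b"
    unfolding r_def using assms by (intro prob_evidence_small_le) auto
  have "AE \<omega> in M. \<eta> < \<bar>posterior Prior p0 n (\<lambda>i. X i \<omega>) A\<bar> \<longrightarrow> \<omega> \<in> ?E1 \<union> ?E2 \<union> ?E3"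
    using AE_evidence_finite[of n] AE_space
  proof eventually_elim
    case (elim \<omega>)
    show ?case
    proof (rule impI, rule ccontr)
      assume gt: "\<eta> < \<bar>posterior Prior p0 n (\<lambda>i. X i \<omega>) A\<bar>" and "\<not> \<omega> \<in> ?E1 \<union> ?E2 \<union> ?E3"
      then have G: "G \<omega>" and Nr: "ennreal r \<le> ?num N \<omega>"
        and less: "ennreal (1 / (\<eta> * r)) * ?num (A \<inter> T) \<omega> < 1"
        using elim by (auto simp: not_less not_le)
      note [measurable] = likelihood_ratio_section_measurable[OF elim(2)]
      have nonneg: "AE q in Prior. 0 \<le> likelihood_ratio n q \<omega>"
        by (rule AE_I2) (intro likelihood_ratio_nonneg prob_density_Prior)
      have int: "integrable Prior (\<lambda>q. likelihood_ratio n q \<omega>)"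
        by (rule integrableI_nonneg) (use nonneg elim(1) in auto)
      define D where "D = (LINT q|Prior. likelihood_ratio n q \<omega>)"
      define U where "U = (LINT q:A|Prior. likelihood_ratio n q \<omega>)"
      have D: "ennreal D = (\<integral>\<^sup>+q. ennreal (likelihood_ratio n q \<omega>) \<partial>Prior)"
        unfolding D_def by (rule nn_integral_eq_integral[symmetric, OF int nonneg])
      have "ennreal U = (\<integral>\<^sup>+q. ennreal (indicator A q *\<^sub>R likelihood_ratio n q \<omega>) \<partial>Prior)"
        unfolding U_def set_lebesgue_integral_def
        by (intro nn_integral_eq_integral[symmetric] integrable_mult_indicator int)
           (use nonneg in \<open>auto simp: indicator_def\<close>)
      also have "\<dots> = ?num (A \<inter> T) \<omega>"
        using T(1) by (intro nn_integral_cong_AE) (auto simp: indicator_def)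
      finally have U: "ennreal U = ?num (A \<inter> T) \<omega>" .
      have pos: "0 \<le> U" "0 \<le> D"
        unfolding U_def D_def set_lebesgue_integral_def
        by (intro integral_nonneg_AE; use nonneg in \<open>auto simp: indicator_def\<close>)+
      have "ennreal r \<le> ennreal D"
        unfolding D using Nr by (rule order_trans) (auto intro!: nn_integral_mono simp: indicator_def)
      then have rD: "r \<le> D" using pos by simp
      have "ennreal (U / (\<eta> * r)) < ennreal 1"
        using less r assms pos unfolding U[symmetric] by (simp flip: ennreal_mult)
      then have "U / (\<eta> * r) < 1"
        using pos r assms by (subst (asm) ennreal_less_iff) auto
      then have "U < \<eta> * r" using r assms by simp
      also have "\<dots> \<le> \<eta> * D" using rD assms by (intro mult_left_mono) auto
      finally have "U / D < \<eta>" using rD r by (simp add: field_simps)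
      moreover have "posterior Prior p0 n (\<lambda>i. X i \<omega>) A = U / D"
        unfolding posterior_eq U_def D_def ..
      ultimately show False using gt pos by simp
    qed
  qed
  then have "prob {\<omega> \<in> space M. \<bar>posterior Prior p0 n (\<lambda>i. X i \<omega>) A\<bar> > \<eta>} \<le> prob (?E1 \<union> ?E2 \<union> ?E3)"
    by (intro finite_measure_mono_AE) auto
  also have "\<dots> \<le> prob ?E1 + prob ?E2 + prob ?E3"
    by (intro order_trans[OF measure_Un_le] add_right_mono measure_Un_le) auto
  also have "\<dots> \<le> prob ?E1 + 2 * b + v / (\<eta> * r)"
    using E2 E3 by simp
  also have "v / (\<eta> * r) = 2 * v / (\<eta> * a * measure Prior N)"
    by (simp add: r_def mult_ac)
  finally show ?thesis by simp
qed

end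

subsection \<open>Contraction rate\<close>

theorem theorem4p1:
  fixes M :: "'a measure" and X :: "nat \<Rightarrow> 'a \<Rightarrow> real"
    and F :: "(real \<Rightarrow> real) set" and p0 :: "real \<Rightarrow> real"
    and Prior :: "nat \<Rightarrow> (real \<Rightarrow> real) measure"
    and eps :: "nat \<Rightarrow> real" and c0 :: real
  assumes "prob_space M"
    and "prob_density p0"
    and "prob_space.indep_vars M (\<lambda>_. borel) X {1..}"
    and "\<And>i. i \<ge> 1 \<Longrightarrow> distributed M lborel (X i) (\<lambda>x. ennreal (p0 x))"
    and "\<And>q. q \<in> F \<Longrightarrow> prob_density q"
    and "(\<lambda>(q, x). q x) \<in> borel_measurable (weak_borel F \<Otimes>\<^sub>M borel)"
    and "\<And>n. prob_space (Prior n)"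
    and "\<And>n. sets (Prior n) = sets (weak_borel F)"
    and "measure (law p0) {0..1} = 1"
    and "0 < c0" and "(INF x\<in>{0..1}. p0 x) \<ge> c0"
    and "decseq eps" and "eps \<longlonglongrightarrow> 0"
    and "\<And>n. n \<ge> 1 \<Longrightarrow> eps n \<ge> sqrt (ln (real n) / real n)"
    and "\<forall>\<^sub>F n in sequentially.
           measure (Prior n) (KL_nbhd F p0 (eps n)) \<ge> exp (- (real n * (eps n)\<^sup>2))"
    and "\<And>n. measure (Prior n) {q \<in> F. measure (law q) {0..1} = 1} = 1"
  shows "\<exists>K>0. tendsto_in_probability M
           (\<lambda>n \<omega>. posterior (Prior n) p0 n (\<lambda>i. X i \<omega>)
              {q \<in> F. W_infinity (law q) (law p0) > ennreal (K * eps n)}) 0"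
proof -
  note F = assms(5) and sets_Prior = assms(8) and supp = assms(16)
  interpret prob_space M by fact
  interpret iid_sample M X p0
    using assms(2-4) by unfold_locales
  have space_Prior: "space (Prior n) = F" for n
    using sets_eq_imp_space_eq[OF sets_Prior[of n]] by simp
  have model: "posterior_model M X p0 (Prior n)" for n
  proof -
    interpret Prior: prob_space "Prior n" by (rule assms(7))
    have "sets (Prior n \<Otimes>\<^sub>M borel) = sets (weak_borel F \<Otimes>\<^sub>M (borel :: real measure))"
      by (intro sets_pair_measure_cong sets_Prior refl)
    then have "(\<lambda>(q, x). q x) \<in> borel_measurable (Prior n \<Otimes>\<^sub>M borel)"
      using assms(6) by (simp cong: measurable_cong_sets)
    then show ?thesis
      by unfold_locales (simp_all add: space_Prior F)
  qed
  have law_p0: "real_distribution (law p0)" by (rule real_distribution_law[OF p0])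
  have c0: "c0 \<le> p0 x" if "x \<in> {0..1}" for x
  proof -
    have "(INF x\<in>{0..1}. p0 x) \<le> p0 x"
      using that prob_densityD(2)[OF p0] by (intro cINF_lower bdd_belowI2[of _ 0]) auto
    with assms(11) show ?thesis by simp
  qed
  \<comment> \<open>This makes the gap \<open>c0 * K * e / 2\<close> equal to \<open>2 * d\<close>
    for \<open>d = 3 / 2 * e\<close>. The test errors then carry
    \<open>exp (- 9 / 2 * n * e^2)\<close>, which beats both the loss
    \<open>exp (- 3 * n * e^2)\<close> from the evidence and the factor \<open>n + 1\<close> from
    the union bound.\<close>
  define K where "K = 6 / c0"
  have K: "K > 0" "c0 * K = 6" using \<open>0 < c0\<close> by (simp_all add: K_def)
  define A where "A = (\<lambda>n. {q \<in> F. W_infinity (law q) (law p0) > ennreal (K * eps n)})"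
  define T where "T = {q \<in> F. measure (law q) {0..1} = 1}"
  have A_sets: "A n \<in> sets (Prior n)" for n
    unfolding A_def sets_Prior by (intro weak_borel_open openin_W_infinity_greater F law_p0)
  \<comment> \<open>A nonmeasurable set has \<open>measure\<close> 0 by default, so prior mass 1
    already implies measurability.\<close>
  have T_sets: "T \<in> sets (Prior n)" for n
    using supp[of n] measure_notin_sets[of T "Prior n"] unfolding T_def by auto
  have AE_T: "AE q in Prior n. q \<in> T" for n
    using prob_space.AE_prob_1[OF assms(7) supp[of n]] unfolding T_def .
  define Y where "Y = (\<lambda>n \<omega>. posterior (Prior n) p0 n (\<lambda>i. X i \<omega>) (A n))"
  have Y_meas: "Y n \<in> borel_measurable M" for n
    unfolding Y_def by (rule posterior_model.posterior_measurable[OF model A_sets])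
  have "(\<lambda>n. prob {\<omega> \<in> space M. \<bar>Y n \<omega>\<bar> > \<eta>}) \<longlonglongrightarrow> 0" if "\<eta> > 0" for \<eta>
  proof (rule tendsto_sandwich[OF _ _ tendsto_const])
    \<comment> \<open>The three error terms after replacing \<open>n * e^2\<close> by its lower
      bound \<open>ln n\<close>; they are of order \<open>n powr (- 7 / 2)\<close>,
      \<open>1 / ln n\<close> and \<open>n powr (- 3 / 2)\<close>.\<close>
    let ?bound = "\<lambda>n. 2 * (real n + 1) * exp (- (9 / 2) * ln (real n)) + 2 * (1 / ln (real n))
        + 2 / \<eta> * exp (- (3 / 2) * ln (real n))"
    show "?bound \<longlonglongrightarrow> 0"
      using \<open>\<eta> > 0\<close> by real_asymp
    show "\<forall>\<^sub>F n in sequentially. 0 \<le> prob {\<omega> \<in> space M. \<bar>Y n \<omega>\<bar> > \<eta>}"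
      by simp
    have "\<forall>\<^sub>F n in sequentially. 2 / real n \<le> K * sqrt (ln (real n) / real n)"
      using K(1) by real_asymp
    then show "\<forall>\<^sub>F n in sequentially. prob {\<omega> \<in> space M. \<bar>Y n \<omega>\<bar> > \<eta>} \<le> ?bound n"
      using assms(15) eventually_gt_at_top[of 1]
    proof eventually_elim
      case (elim n)
      interpret posterior_model M X p0 "Prior n" by (rule model)
      define e where "e = eps n"
      define N where "N = KL_nbhd F p0 e"
      have n: "n > 0" "ln (real n) > 0" using elim by auto
      have e_ge: "sqrt (ln (real n) / real n) \<le> e"
        using assms(14)[of n] elim by (simp add: e_def)
      moreover have "0 < sqrt (ln (real n) / real n)" using n by simp
      ultimately have e: "e > 0" by linarith
      have "ln (real n) / real n \<le> e\<^sup>2"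
        using e_ge n by (simp add: real_sqrt_le_iff sqrt_le_D)
      then have L: "ln (real n) \<le> real n * e\<^sup>2"
        using n by (simp add: field_simps)
      have mesh: "2 / real n \<le> K * e"
        using elim(1) mult_left_mono[OF e_ge, of K] K by linarith
      have PN: "exp (- (real n * e\<^sup>2)) \<le> measure (Prior n) N"
        using elim(2) by (simp add: e_def N_def)
      then have PN_pos: "0 < measure (Prior n) N"
        by (rule less_le_trans[OF exp_gt_zero])
      \<comment> \<open>Positive prior mass gives measurability by the same default value.\<close>
      then have N_sets: "N \<in> sets (Prior n)"
        using measure_notin_sets[of N "Prior n"] by auto
      define v where "v = exp (- 2 * real n * (3 / 2 * e)\<^sup>2)"
      have v: "v = exp (- (9 / 2) * (real n * e\<^sup>2))"
        by (simp add: v_def power2_eq_square)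
      have "prob {\<omega> \<in> space M. \<bar>Y n \<omega>\<bar> > \<eta>}
          \<le> prob {\<omega> \<in> space M. \<not> grid_close n (3 / 2 * e) \<omega>} + 2 * (1 / (real n * e\<^sup>2))
            + 2 * v / (\<eta> * exp (- 2 * real n * e\<^sup>2) * measure (Prior n) N)"
        unfolding Y_def
      proof (rule prob_posterior_gt_le[OF A_sets N_sets grid_close_measurable AE_T T_sets PN_pos])
        show "prob {\<omega> \<in> space M. likelihood_ratio n q \<omega> < exp (- 2 * real n * e\<^sup>2)} \<le> 1 / (real n * e\<^sup>2)"
          if "q \<in> N" for q
          using that n e by (intro prob_likelihood_ratio_small_le) (auto simp: N_def KL_nbhd_def F)
        show "(\<integral>\<^sup>+\<omega>. ennreal (likelihood_ratio n q \<omega>) * indicator {\<omega>. grid_close n (3 / 2 * e) \<omega>} \<omega> \<partial>M)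
            \<le> ennreal v" if "q \<in> A n" "q \<in> T" for q
        proof -
          have q: "prob_density q" "measure (law q) {0..1} = 1"
              "ennreal (K * e) < W_infinity (law q) (law p0)"
            using that F by (auto simp: A_def T_def e_def)
          obtain j where "j \<le> n"
            "\<bar>cdf (law q) (real j / real n) - cdf (law p0) (real j / real n)\<bar> > c0 * (K * e) / 2"
            using W_infinity_gt_imp_cdf_gap_on_grid[OF real_distribution_law[OF q(1)] q(2) p0 assms(9)
                c0 \<open>0 < c0\<close> n(1) mesh q(3)] by auto
          moreover have "c0 * (K * e) / 2 = 2 * (3 / 2 * e)"
            using K(2) by (simp add: mult.assoc[symmetric])
          ultimately show ?thesis
            unfolding v_def using e n
            by (intro nn_integral_likelihood_ratio_grid_close_le[where j = j] q) auto
        qed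
      qed (use n e \<open>\<eta> > 0\<close> in \<open>auto simp: v_def\<close>)
      also have "\<dots> \<le> ?bound n"
      proof (intro add_mono)
        have "prob {\<omega> \<in> space M. \<not> grid_close n (3 / 2 * e) \<omega>} \<le> 2 * (real n + 1) * v"
          using prob_not_grid_close_le[of n "3 / 2 * e"] n e by (simp add: v_def)
        also have "\<dots> \<le> 2 * (real n + 1) * exp (- (9 / 2) * ln (real n))"
          using L unfolding v by (intro mult_left_mono) auto
        finally show "prob {\<omega> \<in> space M. \<not> grid_close n (3 / 2 * e) \<omega>}
            \<le> 2 * (real n + 1) * exp (- (9 / 2) * ln (real n))" .
        show "2 * (1 / (real n * e\<^sup>2)) \<le> 2 * (1 / ln (real n))"
          using L n e by (intro mult_left_mono divide_left_mono mult_pos_pos) auto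
        have "2 * v / (\<eta> * exp (- 2 * real n * e\<^sup>2) * measure (Prior n) N)
            \<le> 2 * v / (\<eta> * exp (- 2 * real n * e\<^sup>2) * exp (- (real n * e\<^sup>2)))"
          using PN \<open>\<eta> > 0\<close> PN_pos by (intro divide_left_mono mult_left_mono mult_pos_pos) (auto simp: v)
        \<comment> \<open>The likelihood threshold contributes 2 and the prior mass 1 to the
          exponent; \<open>v\<close> outweighs them by 3/2.\<close>
        also have "\<dots> = 2 / \<eta> * (v / exp (- 3 * (real n * e\<^sup>2)))"
          by (simp add: exp_add[symmetric] mult.assoc)
        also have "v / exp (- 3 * (real n * e\<^sup>2)) = exp (- (3 / 2) * (real n * e\<^sup>2))"
          unfolding v by (simp add: exp_diff[symmetric])
        also have "2 / \<eta> * \<dots> \<le> 2 / \<eta> * exp (- (3 / 2) * ln (real n))"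
          using L \<open>\<eta> > 0\<close> by (intro mult_left_mono) auto
        finally show "2 * v / (\<eta> * exp (- 2 * real n * e\<^sup>2) * measure (Prior n) N)
            \<le> 2 / \<eta> * exp (- (3 / 2) * ln (real n))" .
      qed
      finally show ?case .
    qed
  qed
  then have "tendsto_in_probability M Y 0"
    using Y_meas by (simp add: tendsto_in_probability_def)
  with K(1) show ?thesis
    unfolding Y_def A_def by blast
qed

end
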